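(* Let $n\ge3$ and let $1\le q<p$ be integers. If an algebraic curvature operator $R\in\operatorname{Sym}^2_b(\wedge^2\mathbb R^n)$ satisfies $C_p(R)\ge0$, then $$\tfrac{\mathrm{scal}}4\ge C_q(R)\ge C_p(R).$$
   Context: $\operatorname{Sym}^2_b(\wedge^2\mathbb R^n)$ is the space of self-adjoint operators $R\colon\wedge^2\mathbb R^n\to\wedge^2\mathbb R^n$ satisfying the first Bianchi identity; $\mathrm{Ric}$ and $\mathrm{scal}$ are the Ricci operator and scalar curvature of $R$, normalized so that $R=\operatorname{Id}$ has sectional curvature $1$; in particular $\mathrm{scal}=2\operatorname{tr}R$. For a self-adjoint operator $A$ with eigenvalues $\nu_1\le\dots\le\nu_d$ and real $0<r\le d$, $\Sigma(r,A)=\nu_1+\dots+\nu_{\lfloor r\rfloor}+(r-\lfloor r\rfloor)\nu_{\lfloor r\rfloor+1}$. For integers $p\ge1$, $$r_p=\frac{n^2+(8p-1)n+8p(p-1)}{n+8p(p+1)},\qquad r'_p=\frac{n+p-2}p.$$ With $\mu$ the largest eigenvalue of $\mathrm{Ric}$, $$C_1(R)=\min\Big\{\big(\tfrac n8+2\big)\Sigma(r_1,R),\tfrac{\mathrm{scal}}8\Big\}+\tfrac{\mathrm{scal}}8-\mu,$$ $$C_p(R)=\min\Big\{\big(\tfrac n8+p^2+p\big)\Sigma(r_p,R),\tfrac{n(n-1)}{8r_p}\Sigma(r_p,R)\Big\}+\tfrac{\mathrm{scal}}8+p^2\,\Sigma(r'_p,-R)\quad(p\ge2).$$ *)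

theory Defs
  imports "HOL-Analysis.Analysis"
begin

section \<open>Eigenvalues of an operator on a subspace\<close>

text \<open>An operator on a linear subspace \<open>V\<close> is given by a function on the ambient type; only its
  values on \<open>V\<close> enter the definitions below.\<close>

definition eigenspace :: "'a::real_vector set \<Rightarrow> ('a \<Rightarrow> 'a) \<Rightarrow> real \<Rightarrow> 'a set" where
  "eigenspace V A \<nu> = {v \<in> V. A v = \<nu> *\<^sub>R v}"

definition eigenvalues :: "'a::real_vector set \<Rightarrow> ('a \<Rightarrow> 'a) \<Rightarrow> real set" where
  "eigenvalues V A = {\<nu>. \<exists>v \<in> V. v \<noteq> 0 \<and> A v = \<nu> *\<^sub>R v}"

text \<open>The list \<open>\<nu>\<^sub>1 \<le> \<dots> \<le> \<nu>\<^sub>d\<close>, each eigenvalue repeated according to the dimension of its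
  eigenspace (for a self-adjoint operator, its algebraic multiplicity). List positions count from 0.\<close>

definition eigenvalue_list :: "'a::real_vector set \<Rightarrow> ('a \<Rightarrow> 'a) \<Rightarrow> real list" where
  "eigenvalue_list V A =
     concat (map (\<lambda>\<nu>. replicate (dim (eigenspace V A \<nu>)) \<nu>) (sorted_list_of_set (eigenvalues V A)))"

text \<open>\<open>\<Sigma>(r, A)\<close> for \<open>0 < r \<le> d\<close>. If \<open>r = d\<close>, the entry beyond the end of the list has
  coefficient 0.\<close>

definition eig_sum :: "'a::real_vector set \<Rightarrow> real \<Rightarrow> ('a \<Rightarrow> 'a) \<Rightarrow> real" where
  "eig_sum V r A =
     (let \<nu> = eigenvalue_list V A; k = nat \<lfloor>r\<rfloor>
      in (\<Sum>i<k. \<nu> ! i) + (r - of_int \<lfloor>r\<rfloor>) * \<nu> ! k)"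


section \<open>Algebraic curvature operators\<close>

text \<open>\<open>\<Lambda>\<^sup>2 \<real>\<^sup>n\<close> is modelled by the skew-symmetric matrices, \<open>x \<wedge> y\<close> being \<open>x y\<^sup>T - y x\<^sup>T\<close>.\<close>

definition wedge2 :: "(real^'n^'n) set" where
  "wedge2 = {\<omega>. transpose \<omega> = - \<omega>}"

definition wedge :: "real^'n \<Rightarrow> real^'n \<Rightarrow> real^'n^'n" where
  "wedge x y = (\<chi> i j. x $ i * y $ j - y $ i * x $ j)"

text \<open>The factor \<open>1/2\<close> makes \<open>e\<^sub>i \<wedge> e\<^sub>j\<close> (\<open>i < j\<close>) orthonormal; the library's inner product on
  matrices sums over all pairs \<open>(i, j)\<close>.\<close>

definition wedge_inner :: "real^'n^'n \<Rightarrow> real^'n^'n \<Rightarrow> real" where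
  "wedge_inner \<omega> \<eta> = (\<omega> \<bullet> \<eta>) / 2"

lemma wedge_in_wedge2: "wedge x y \<in> wedge2"
  by (simp add: wedge2_def wedge_def transpose_def vec_eq_iff)

lemma wedge_inner_wedge:
  "wedge_inner (wedge x y) (wedge z w) = (x \<bullet> z) * (y \<bullet> w) - (x \<bullet> w) * (y \<bullet> z)"
proof -
  have *: "(\<Sum>i\<in>UNIV. \<Sum>j\<in>UNIV. (a $ i * b $ j) * (c $ i * d $ j)) = (a \<bullet> c) * (b \<bullet> d)"
    for a b c d :: "real^'n"
    by (simp add: inner_vec_def sum_product algebra_simps)
  have "wedge x y \<bullet> wedge z w = (\<Sum>i\<in>UNIV. \<Sum>j\<in>UNIV.
      (x $ i * y $ j) * (z $ i * w $ j) - (x $ i * y $ j) * (w $ i * z $ j)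
      - (y $ i * x $ j) * (z $ i * w $ j) + (y $ i * x $ j) * (w $ i * z $ j))"
    by (simp add: inner_vec_def wedge_def algebra_simps)
  also have "\<dots> = 2 * ((x \<bullet> z) * (y \<bullet> w) - (x \<bullet> w) * (y \<bullet> z))"
    by (simp only: sum.distrib sum_subtractf *) (simp add: algebra_simps)
  finally show ?thesis by (simp add: wedge_inner_def)
qed

definition linear_operator_on :: "'a::real_vector set \<Rightarrow> ('a \<Rightarrow> 'a) \<Rightarrow> bool" where
  "linear_operator_on V A \<longleftrightarrow>
     (\<forall>v\<in>V. A v \<in> V) \<and>
     (\<forall>v\<in>V. \<forall>w\<in>V. A (v + w) = A v + A w) \<and>
     (\<forall>c. \<forall>v\<in>V. A (c *\<^sub>R v) = c *\<^sub>R A v)"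

definition Sym2b :: "(real^'n^'n \<Rightarrow> real^'n^'n) set" where
  "Sym2b = {R. linear_operator_on wedge2 R \<and>
     (\<forall>\<omega>\<in>wedge2. \<forall>\<eta>\<in>wedge2. wedge_inner (R \<omega>) \<eta> = wedge_inner \<omega> (R \<eta>)) \<and>
     (\<forall>x y z w. wedge_inner (R (wedge x y)) (wedge z w)
              + wedge_inner (R (wedge y z)) (wedge x w)
              + wedge_inner (R (wedge z x)) (wedge y w) = 0)}"

definition Ric :: "(real^'n^'n \<Rightarrow> real^'n^'n) \<Rightarrow> real^'n \<Rightarrow> real^'n" where
  "Ric R x = (\<chi> k. \<Sum>i\<in>UNIV. wedge_inner (R (wedge (axis i 1) x)) (wedge (axis i 1) (axis k 1)))"

definition scal :: "(real^'n^'n \<Rightarrow> real^'n^'n) \<Rightarrow> real" where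
  "scal R = trace (matrix (Ric R))"

text \<open>The normalization: the identity has sectional curvature 1.\<close>

lemma Ric_id: "Ric (\<lambda>\<omega>. \<omega>) x = (real CARD('n) - 1) *\<^sub>R (x :: real^'n)"
proof -
  have "(\<Sum>i\<in>UNIV. x $ i * (axis i 1 \<bullet> (axis k 1 :: real^'n))) = x $ k" for k
    by (simp add: inner_axis_axis if_distrib cong: if_cong)
  then show ?thesis
    by (simp add: Ric_def wedge_inner_wedge vec_eq_iff inner_axis inner_axis' sum_subtractf
        inner_commute algebra_simps)
qed

lemma scal_id: "scal (\<lambda>\<omega>::real^'n^'n. \<omega>) = real CARD('n) * (real CARD('n) - 1)"
  by (simp add: scal_def trace_def matrix_def Ric_id)

text \<open>Each unordered pair occurs twice in this sum, which is therefore \<open>2 tr R\<close>.\<close>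

lemma scal_eq_sum:
  "scal R = (\<Sum>k\<in>UNIV. \<Sum>i\<in>UNIV.
     wedge_inner (R (wedge (axis i 1) (axis k 1))) (wedge (axis i 1) (axis k 1)))"
  by (simp add: scal_def trace_def matrix_def Ric_def)


section \<open>The curvature quantities\<close>

definition r_par :: "nat \<Rightarrow> nat \<Rightarrow> real" where
  "r_par n p = ((real n)\<^sup>2 + (8 * real p - 1) * real n + 8 * real p * (real p - 1))
             / (real n + 8 * real p * (real p + 1))"

definition r_par' :: "nat \<Rightarrow> nat \<Rightarrow> real" where
  "r_par' n p = (real n + real p - 2) / real p"

definition curv_C :: "nat \<Rightarrow> (real^'n^'n \<Rightarrow> real^'n^'n) \<Rightarrow> real" where
  "curv_C p R =
     (let n = CARD('n); S = eig_sum wedge2 (r_par n p) R in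
      if p = 1 then
        min ((real n / 8 + 2) * S) (scal R / 8) + scal R / 8 - Max (eigenvalues UNIV (Ric R))
      else
        min ((real n / 8 + (real p)\<^sup>2 + real p) * S) (real n * (real n - 1) / (8 * r_par n p) * S)
        + scal R / 8 + (real p)\<^sup>2 * eig_sum wedge2 (r_par' n p) (\<lambda>\<omega>. - R \<omega>))"

end

theory Submission imports Defs begin

text \<open>By the spectral theorem, \<open>\<Sigma>(r, A)\<close> is the minimum of \<open>\<Sum>\<^sub>i w\<^sub>i \<nu>\<^sub>i\<close> over weights
  \<open>w\<^sub>i \<in> [0, 1]\<close> of total \<open>r\<close>, so the averages \<open>\<Sigma>(r, A) / r\<close> increase with \<open>r\<close> up to \<open>tr A / d\<close>.
  Let \<open>K = n(n - 1)/8\<close>, and let \<open>s\<^sub>p\<close>, \<open>t\<^sub>p\<close>, \<open>m\<close> be the averages \<open>\<Sigma>(r\<^sub>p, R)/r\<^sub>p\<close>,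
  \<open>\<Sigma>(r'\<^sub>p, -R)/r'\<^sub>p\<close> and \<open>scal/(n(n - 1))\<close>. Since \<open>(n/8 + p\<^sup>2 + p) r\<^sub>p = K + p(n + p - 1)\<close> and
  \<open>p\<^sup>2 r'\<^sub>p = p(n + p - 2)\<close>, for \<open>p \<ge> 2\<close>
  \<open>C\<^sub>p = min {(K + p(n + p - 1)) s\<^sub>p, K s\<^sub>p} + K m + p(n + p - 2) t\<^sub>p\<close>,
  where \<open>s\<^sub>p \<le> m\<close> and \<open>t\<^sub>p \<le> -m\<close>. If \<open>m < 0\<close>, this is at most \<open>(2K + p) m < 0\<close>; hence \<open>m \<ge> 0\<close>
  and \<open>t\<^sub>p \<le> 0\<close>. As \<open>r\<^sub>p\<close> and \<open>r'\<^sub>p\<close> decrease in \<open>p\<close>, the averages \<open>s\<^sub>p\<close> and \<open>t\<^sub>p\<close> do too, and the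
  inequalities hold term by term. For \<open>q = 1\<close> one uses \<open>0 \<le> \<mu> \<le> -\<Sigma>(n - 1, -R)\<close>, because
  \<open>\<langle>Ric x, x\<rangle>\<close> is the trace of \<open>R\<close> on the \<open>(n - 1)\<close>-dimensional space of all \<open>x \<and> y\<close>.\<close>

section \<open>Spectral theorem on a subspace\<close>

text \<open>The ambient inner product is used. On \<open>wedge2\<close> it is twice
  \<open>wedge_inner\<close>, which leaves self-adjointness unchanged.\<close>

definition self_adjoint_on :: "'a::euclidean_space set \<Rightarrow> ('a \<Rightarrow> 'a) \<Rightarrow> bool" where
  "self_adjoint_on V A \<longleftrightarrow>
     subspace V \<and> linear_operator_on V A \<and> (\<forall>v\<in>V. \<forall>w\<in>V. A v \<bullet> w = v \<bullet> A w)"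

lemma self_adjoint_onD:
  assumes "self_adjoint_on V A"
  shows "subspace V"
    and "v \<in> V \<Longrightarrow> A v \<in> V"
    and "v \<in> V \<Longrightarrow> w \<in> V \<Longrightarrow> A (v + w) = A v + A w"
    and "v \<in> V \<Longrightarrow> A (c *\<^sub>R v) = c *\<^sub>R A v"
    and "v \<in> V \<Longrightarrow> w \<in> V \<Longrightarrow> A v \<bullet> w = v \<bullet> A w"
  using assms unfolding self_adjoint_on_def linear_operator_on_def by blast+

lemma self_adjoint_on_uminus:
  assumes "self_adjoint_on V A"
  shows "self_adjoint_on V (\<lambda>v. - A v)"
  using assms by (auto simp: self_adjoint_on_def linear_operator_on_def subspace_neg)

lemma self_adjoint_on_sum:
  assumes A: "self_adjoint_on V A" and "finite I" "\<And>i. i \<in> I \<Longrightarrow> f i \<in> V"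
  shows "A (\<Sum>i\<in>I. f i) = (\<Sum>i\<in>I. A (f i))"
  using assms(2,3)
proof (induction I rule: finite_induct)
  case empty
  then show ?case
    using self_adjoint_onD(4)[OF A, of 0 0] self_adjoint_onD(1)[OF A] by (simp add: subspace_0)
next
  case (insert i I)
  have "(\<Sum>i\<in>I. f i) \<in> V"
    using insert.prems self_adjoint_onD(1)[OF A] by (auto intro: subspace_sum)
  then show ?case
    using insert self_adjoint_onD(3)[OF A] by simp
qed

text \<open>Only the values on \<open>V\<close> are known to be linear; expanding in an orthonormal
  basis of \<open>V\<close> writes \<open>A\<close> there as a finite sum of continuous
  maps.\<close>

lemma self_adjoint_on_continuous_on:
  assumes A: "self_adjoint_on V A"
  shows "continuous_on V A"
proof -
  have V: "subspace V" by (rule self_adjoint_onD(1)[OF A])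
  obtain B where B: "finite B" "B \<subseteq> V" "pairwise orthogonal B" "\<And>b. b \<in> B \<Longrightarrow> norm b = 1"
      "span B = V"
    using orthonormal_basis_subspace[OF V] by (metis independent_imp_finite)
  have "A x = (\<Sum>b\<in>B. (x \<bullet> b) *\<^sub>R A b)" if "x \<in> V" for x
  proof -
    have "A x = A (\<Sum>b\<in>B. (x \<bullet> b) *\<^sub>R b)"
      using orthonormal_basis_expand[OF B(3,4) _ B(1)] B(5) that by simp
    also have "\<dots> = (\<Sum>b\<in>B. A ((x \<bullet> b) *\<^sub>R b))"
      using B V by (intro self_adjoint_on_sum[OF A]) (auto intro: subspace_scale)
    also have "\<dots> = (\<Sum>b\<in>B. (x \<bullet> b) *\<^sub>R A b)"
      using B self_adjoint_onD(4)[OF A] by (auto intro!: sum.cong)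
    finally show ?thesis .
  qed
  moreover have "continuous_on V (\<lambda>x. \<Sum>b\<in>B. (x \<bullet> b) *\<^sub>R A b)"
    by (intro continuous_intros)
  ultimately show ?thesis by (simp cong: continuous_on_cong)
qed

text \<open>A maximizer of the Rayleigh quotient is an eigenvector.\<close>

lemma self_adjoint_on_eigenvector_exists:
  assumes A: "self_adjoint_on V A" and "V \<noteq> {0}"
  obtains v \<mu> where "v \<in> V" "norm v = 1" "A v = \<mu> *\<^sub>R v"
proof -
  note AD = self_adjoint_onD[OF A]
  have V: "subspace V" by (rule AD(1))
  obtain u where u: "u \<in> V" "u \<noteq> 0"
    using \<open>V \<noteq> {0}\<close> V subspace_0 by blast
  let ?S = "sphere 0 1 \<inter> V"
  have "compact ?S"
    using V by (intro compact_Int_closed closed_subspace) auto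
  moreover have "(1 / norm u) *\<^sub>R u \<in> ?S"
    using u V by (auto intro: subspace_scale)
  then have "?S \<noteq> {}" by blast
  moreover have "continuous_on ?S (\<lambda>x. A x \<bullet> x)"
    by (intro continuous_intros continuous_on_subset[OF self_adjoint_on_continuous_on[OF A]]) auto
  ultimately obtain v where v: "v \<in> ?S" and max: "\<And>x. x \<in> ?S \<Longrightarrow> A x \<bullet> x \<le> A v \<bullet> v"
    using continuous_attains_sup[of ?S "\<lambda>x. A x \<bullet> x"] by blast
  define \<mu> where "\<mu> = A v \<bullet> v"
  have vV: "v \<in> V" and v1: "norm v = 1" using v by auto
  have ray: "A x \<bullet> x \<le> \<mu> * (x \<bullet> x)" if x: "x \<in> V" for x
  proof (cases "x = 0")
    case True
    then show ?thesis by simp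
  next
    case False
    have "(1 / norm x) *\<^sub>R x \<in> ?S"
      using x V False by (auto intro: subspace_scale)
    from max[OF this] show ?thesis
      using False x AD(4)[OF x]
      by (simp add: \<mu>_def field_simps power2_norm_eq_inner[symmetric] power2_eq_square)
  qed
  define w where "w = A v - \<mu> *\<^sub>R v"
  have wV: "w \<in> V"
    unfolding w_def using vV V AD(2) by (auto intro: subspace_diff subspace_scale)
  define c where "c = \<mu> * (w \<bullet> w) - A w \<bullet> w"
  \<comment> \<open>Comparing the Rayleigh quotient at \<open>v\<close> and at
    \<open>v + t *\<^sub>R w\<close>: the first-order gain is bounded by a second-order term for
    every t, which forces w = 0.\<close>
  have key: "2 * t * (w \<bullet> w) \<le> t\<^sup>2 * c" for t
  proof -
    have tw: "t *\<^sub>R w \<in> V" using wV V by (rule subspace_scale[rotated])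
    have "A (v + t *\<^sub>R w) = A v + t *\<^sub>R A w"
      using AD(3)[OF vV tw] AD(4)[OF wV] by simp
    moreover have "v + t *\<^sub>R w \<in> V" using vV tw V by (intro subspace_add)
    ultimately have "(A v + t *\<^sub>R A w) \<bullet> (v + t *\<^sub>R w) \<le> \<mu> * ((v + t *\<^sub>R w) \<bullet> (v + t *\<^sub>R w))"
      using ray by metis
    moreover have "A w \<bullet> v = A v \<bullet> w"
      using AD(5)[OF wV vV] by (simp add: inner_commute)
    moreover have "v \<bullet> v = 1" using v1 by (simp add: norm_eq_1)
    moreover have "w \<bullet> A v = A v \<bullet> w" "w \<bullet> v = v \<bullet> w" by (simp_all add: inner_commute)
    ultimately have "2 * t * (A v \<bullet> w - \<mu> * (v \<bullet> w)) \<le> t\<^sup>2 * c"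
      by (simp add: c_def \<mu>_def[symmetric] inner_add_left inner_add_right power2_eq_square algebra_simps)
    moreover have "w \<bullet> w = A v \<bullet> w - \<mu> * (v \<bullet> w)"
      by (subst (1) w_def) (simp add: inner_diff_left)
    ultimately show ?thesis by simp
  qed
  have "w \<bullet> w = 0"
  proof (rule ccontr)
    assume "w \<bullet> w \<noteq> 0"
    then have pos: "w \<bullet> w > 0" by simp
    \<comment> \<open>Chosen so small that t c \<le> w \<bullet> w, against
      \<open>key\<close>.\<close>
    define t where "t = (w \<bullet> w) / (\<bar>c\<bar> + 1)"
    have t: "t > 0" using pos by (simp add: t_def add_nonneg_pos)
    have "t * (2 * (w \<bullet> w)) \<le> t * (t * c)"
      using key[of t] by (simp add: power2_eq_square mult_ac)
    then have "2 * (w \<bullet> w) \<le> t * c" using t by simp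
    also have "\<dots> \<le> t * (\<bar>c\<bar> + 1)" using t by (intro mult_left_mono) auto
    also have "\<dots> = w \<bullet> w" by (simp add: t_def)
    finally show False using pos by simp
  qed
  then have "A v = \<mu> *\<^sub>R v" by (simp add: w_def)
  with vV v1 show thesis by (rule that)
qed

text \<open>Induction on the dimension: split off a unit eigenvector v. Its orthogonal complement in
  \<open>V\<close> is invariant, since A w \<bullet> v = w \<bullet> A v is a multiple of w
  \<bullet> v.\<close>

lemma self_adjoint_on_eigenbasis_set:
  assumes "self_adjoint_on V A"
  shows "\<exists>B. finite B \<and> B \<subseteq> V \<and> pairwise orthogonal B \<and> (\<forall>b\<in>B. norm b = 1) \<and> span B = V
    \<and> (\<forall>b\<in>B. \<exists>\<mu>. A b = \<mu> *\<^sub>R b)"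
  using assms
proof (induction "dim V" arbitrary: V rule: less_induct)
  case less
  note AD = self_adjoint_onD[OF less.prems]
  have V: "subspace V" by (rule AD(1))
  show ?case
  proof (cases "V = {0}")
    case True
    then show ?thesis by (intro exI[of _ "{}"]) auto
  next
    case False
    then obtain v \<mu> where v: "v \<in> V" "norm v = 1" "A v = \<mu> *\<^sub>R v"
      using self_adjoint_on_eigenvector_exists[OF less.prems] by metis
    have vv: "v \<bullet> v = 1" using v(2) by (simp add: norm_eq_1)
    define W where "W = {w \<in> V. w \<bullet> v = 0}"
    have WV: "W \<subseteq> V" by (auto simp: W_def)
    have W: "subspace W"
      using V by (auto simp: W_def subspace_def inner_add_left)
    have "A w \<bullet> v = 0" if "w \<in> W" for w
      using that AD(5)[of w v] v by (simp add: W_def)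
    then have "self_adjoint_on W A"
      using W AD unfolding self_adjoint_on_def linear_operator_on_def W_def by auto
    moreover have "v \<notin> W" using vv by (simp add: W_def)
    then have "dim W < dim V"
      using WV W V v(1) by (metis dim_subset le_neq_implies_less subspace_dim_equal order_refl)
    ultimately obtain B where B: "finite B" "B \<subseteq> W" "pairwise orthogonal B" "\<forall>b\<in>B. norm b = 1"
        "span B = W" "\<forall>b\<in>B. \<exists>\<mu>. A b = \<mu> *\<^sub>R b"
      using less.hyps by metis
    have "x \<in> span (insert v B)" if "x \<in> V" for x
    proof -
      have "x - (x \<bullet> v) *\<^sub>R v \<in> W"
        using that v(1) V vv by (auto simp: W_def inner_diff_left intro: subspace_diff subspace_scale)
      then show ?thesis unfolding span_insert using B(5) by blast
    qed
    moreover have "span (insert v B) \<subseteq> V"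
      using V v B(2) WV by (intro span_minimal) auto
    ultimately have "span (insert v B) = V" by blast
    moreover have "pairwise orthogonal (insert v B)"
      using B(2,3) by (auto simp: pairwise_insert orthogonal_def W_def inner_commute)
    ultimately show ?thesis
      using B v WV by (intro exI[of _ "insert v B"]) auto
  qed
qed

section \<open>Multiplicities, the sorted eigenvalue list and orthonormal eigenbases\<close>

lemma sorted_concat_replicate:
  assumes "sorted xs"
  shows "sorted (concat (map (\<lambda>x. replicate (f x) x) xs))"
  using assms by (induction xs) (auto simp: sorted_append)

lemma count_concat_replicate:
  assumes "distinct xs"
  shows "count_list (concat (map (\<lambda>x. replicate (f x) x) xs)) y = (if y \<in> set xs then f y else 0)"
  using assms
proof (induction xs)
  case (Cons x xs)
  have "count_list (replicate k x) y = (if x = y then k else 0)" for k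
    by (induction k) auto
  with Cons show ?case by auto
qed simp

text \<open>The vectors are indexed along the sorted list. Parseval's identity encodes
  orthogonality: applied to \<open>e j\<close>, it leaves no room for a second nonzero
  coefficient.\<close>

definition eigenbasis :: "'a::euclidean_space set \<Rightarrow> ('a \<Rightarrow> 'a) \<Rightarrow> (nat \<Rightarrow> 'a) \<Rightarrow> bool" where
  "eigenbasis V A e \<longleftrightarrow>
     (\<forall>i<dim V. e i \<in> V \<and> norm (e i) = 1 \<and> A (e i) = (eigenvalue_list V A ! i) *\<^sub>R e i) \<and>
     (\<forall>x\<in>V. (\<Sum>i<dim V. (x \<bullet> e i)\<^sup>2) = x \<bullet> x) \<and>
     (\<forall>x\<in>V. A x \<bullet> x = (\<Sum>i<dim V. eigenvalue_list V A ! i * (x \<bullet> e i)\<^sup>2))"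

lemma eigenbasisD:
  assumes "eigenbasis V A e"
  shows "i < dim V \<Longrightarrow> e i \<in> V"
    and "i < dim V \<Longrightarrow> norm (e i) = 1"
    and "i < dim V \<Longrightarrow> A (e i) = (eigenvalue_list V A ! i) *\<^sub>R e i"
    and "x \<in> V \<Longrightarrow> (\<Sum>i<dim V. (x \<bullet> e i)\<^sup>2) = x \<bullet> x"
    and "x \<in> V \<Longrightarrow> A x \<bullet> x = (\<Sum>i<dim V. eigenvalue_list V A ! i * (x \<bullet> e i)\<^sup>2)"
  using assms unfolding eigenbasis_def by blast+

text \<open>Take an orthonormal basis B of eigenvectors with eigenvalues l. Each eigenspace is
  spanned by the members of B it contains, so multiplicities count elements of B, and sorting B by l
  reproduces the list.\<close>

lemma self_adjoint_on_eigenbasis: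
  assumes A: "self_adjoint_on V A"
  shows length_eigenvalue_list: "length (eigenvalue_list V A) = dim V"
    and sorted_eigenvalue_list: "sorted (eigenvalue_list V A)"
    and set_eigenvalue_list: "set (eigenvalue_list V A) = eigenvalues V A"
    and eigenbasis_exists: "\<exists>e. eigenbasis V A e"
proof -
  note AD = self_adjoint_onD[OF A]
  obtain B where B: "finite B" "B \<subseteq> V" "pairwise orthogonal B" "\<forall>b\<in>B. norm b = 1"
        "span B = V" "\<forall>b\<in>B. \<exists>\<mu>. A b = \<mu> *\<^sub>R b"
    using self_adjoint_on_eigenbasis_set[OF A] by metis
  from B(6) obtain l where l: "\<And>b. b \<in> B \<Longrightarrow> A b = l b *\<^sub>R b" by metis
  have expand: "(\<Sum>b\<in>B. (x \<bullet> b) *\<^sub>R b) = x" if "x \<in> V" for x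
    using orthonormal_basis_expand[OF B(3) _ _ B(1)] B(4,5) that by simp
  have ind: "independent C" if "C \<subseteq> B" for C
    using that B(3,4)
    by (intro pairwise_orthogonal_independent) (blast intro: pairwise_subset, force)
  have coeff: "x \<bullet> b = 0" if x: "x \<in> V" "A x = \<nu> *\<^sub>R x" and b: "b \<in> B" "l b \<noteq> \<nu>" for x b \<nu>
  proof -
    have "A x \<bullet> b = x \<bullet> A b" using AD(5) x b B(2) by blast
    then have "\<nu> * (x \<bullet> b) = l b * (x \<bullet> b)" using x l[OF b(1)] by simp
    then show ?thesis using b by simp
  qed
  have esp: "eigenspace V A \<nu> = span {b\<in>B. l b = \<nu>}" for \<nu>
  proof (rule antisym)
    show "eigenspace V A \<nu> \<subseteq> span {b\<in>B. l b = \<nu>}"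
    proof
      fix x assume "x \<in> eigenspace V A \<nu>"
      then have x: "x \<in> V" "A x = \<nu> *\<^sub>R x" by (auto simp: eigenspace_def)
      have "x = (\<Sum>b\<in>B. (x \<bullet> b) *\<^sub>R b)" using expand x by simp
      also have "\<dots> \<in> span {b\<in>B. l b = \<nu>}"
      proof (rule span_sum)
        fix b assume "b \<in> B"
        then show "(x \<bullet> b) *\<^sub>R b \<in> span {b\<in>B. l b = \<nu>}"
          using coeff[OF x] by (cases "l b = \<nu>") (auto intro: span_scale span_base span_zero)
      qed
      finally show "x \<in> span {b\<in>B. l b = \<nu>}" .
    qed
    have "subspace (eigenspace V A \<nu>)"
      unfolding eigenspace_def subspace_def
      using AD(3,4) AD(1) AD(4)[of 0 0]
      by (auto simp: subspace_0 subspace_add subspace_scale algebra_simps)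
    then show "span {b\<in>B. l b = \<nu>} \<subseteq> eigenspace V A \<nu>"
      using B(2) l by (intro span_minimal) (auto simp: eigenspace_def)
  qed
  have dime: "dim (eigenspace V A \<nu>) = card {b\<in>B. l b = \<nu>}" for \<nu>
    unfolding esp by (rule dim_span_eq_card_independent) (rule ind, blast)
  have ev: "eigenvalues V A = l ` B"
  proof (intro antisym subsetI)
    fix \<nu> assume "\<nu> \<in> eigenvalues V A"
    then obtain x where x: "x \<in> V" "A x = \<nu> *\<^sub>R x" "x \<noteq> 0" by (auto simp: eigenvalues_def)
    show "\<nu> \<in> l ` B"
    proof (rule ccontr)
      assume "\<nu> \<notin> l ` B"
      then have "x \<bullet> b = 0" if "b \<in> B" for b using coeff[OF x(1,2) that] that by blast
      then have "(\<Sum>b\<in>B. (x \<bullet> b) *\<^sub>R b) = 0" by simp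
      then show False using expand[OF x(1)] x(3) by simp
    qed
  next
    fix \<nu> assume "\<nu> \<in> l ` B"
    then obtain b where b: "b \<in> B" "\<nu> = l b" by blast
    then have "b \<in> V" "b \<noteq> 0" "A b = \<nu> *\<^sub>R b" using B(2,4) l[OF b(1)] by auto
    then show "\<nu> \<in> eigenvalues V A" unfolding eigenvalues_def by blast
  qed
  obtain xs where xs: "set xs = B" "distinct xs" using finite_distinct_list[OF B(1)] by blast
  define bs where "bs = sort_key l xs"
  have bs: "set bs = B" "distinct bs" "sorted (map l bs)" using xs by (auto simp: bs_def)
  have "count_list (map l bs) y = card {b\<in>B. l b = y}" for y
  proof -
    have "count_list (map l bs) y = length (filter (\<lambda>b. l b = y) bs)"
      by (induction bs) auto
    also have "\<dots> = card (set (filter (\<lambda>b. l b = y) bs))"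
      using bs(2) by (intro distinct_card[symmetric] distinct_filter)
    finally show ?thesis using bs(1) by simp
  qed
  moreover have "count_list (eigenvalue_list V A) y = card {b\<in>B. l b = y}" for y
    using count_concat_replicate[of "sorted_list_of_set (eigenvalues V A)"
        "\<lambda>\<nu>. dim (eigenspace V A \<nu>)" y] B(1)
    by (auto simp: eigenvalue_list_def ev dime)
  ultimately have "mset (map l bs) = mset (eigenvalue_list V A)"
    by (intro multiset_eqI) (simp only: count_mset)
  moreover have "sorted (eigenvalue_list V A)"
    unfolding eigenvalue_list_def by (intro sorted_concat_replicate) simp
  ultimately have el: "eigenvalue_list V A = map l bs"
    using bs(3) properties_for_sort by metis
  have "dim V = card B"
    using dim_span_eq_card_independent[OF ind[OF order_refl]] B(5) by simp
  then have d: "dim V = length bs" using distinct_card[OF bs(2)] bs(1) by simp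
  define e where "e i = bs ! i" for i
  have eB: "e i \<in> B" if "i < dim V" for i
    using that d bs(1) by (auto simp: e_def)
  have Ae: "A (e i) = (eigenvalue_list V A ! i) *\<^sub>R e i" if "i < dim V" for i
    using l[OF eB[OF that]] that d by (simp add: el e_def)
  have bij: "bij_betw e {..<dim V} B"
    unfolding e_def using bij_betw_nth[OF bs(2) _ bs(1)[symmetric]] d by auto
  have ex: "(\<Sum>i<dim V. (x \<bullet> e i) *\<^sub>R e i) = x" if "x \<in> V" for x
    using sum.reindex_bij_betw[OF bij, of "\<lambda>b. (x \<bullet> b) *\<^sub>R b"] expand[OF that] by simp
  have inn: "(\<Sum>i<dim V. (x \<bullet> e i) * (y \<bullet> e i)) = x \<bullet> y" if "x \<in> V" for x y
  proof -
    have "(\<Sum>i<dim V. (x \<bullet> e i) *\<^sub>R e i) \<bullet> y = (\<Sum>i<dim V. (x \<bullet> e i) * (y \<bullet> e i))"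
      by (simp add: inner_sum_left inner_commute[of y])
    then show ?thesis using ex[OF that] by simp
  qed
  have quad: "A x \<bullet> x = (\<Sum>i<dim V. eigenvalue_list V A ! i * (x \<bullet> e i)\<^sup>2)" if x: "x \<in> V" for x
  proof -
    have "x \<bullet> A x = (\<Sum>i<dim V. (x \<bullet> e i) * (A x \<bullet> e i))" using inn[OF x] by simp
    also have "\<dots> = (\<Sum>i<dim V. eigenvalue_list V A ! i * (x \<bullet> e i)\<^sup>2)"
    proof (intro sum.cong refl)
      fix i assume i: "i \<in> {..<dim V}"
      then have "A x \<bullet> e i = x \<bullet> A (e i)" using AD(5)[OF x] eB B(2) by blast
      then show "(x \<bullet> e i) * (A x \<bullet> e i) = eigenvalue_list V A ! i * (x \<bullet> e i)\<^sup>2"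
        using Ae i by (simp add: power2_eq_square)
    qed
    finally show ?thesis by (simp add: inner_commute)
  qed
  show "length (eigenvalue_list V A) = dim V" by (simp add: el d)
  show "sorted (eigenvalue_list V A)" by (simp add: el bs)
  show "set (eigenvalue_list V A) = eigenvalues V A" by (simp add: el bs ev)
  have "eigenbasis V A e"
    unfolding eigenbasis_def using eB B(2,4) Ae inn quad by (auto simp: power2_eq_square)
  then show "\<exists>e. eigenbasis V A e" by blast
qed

text \<open>In an eigenbasis, A x \<bullet> x weights the eigenvalues by squared coefficients of
  total x \<bullet> x.\<close>

lemma self_adjoint_on_le_Max_eigenvalues:
  assumes A: "self_adjoint_on V A" and x: "x \<in> V"
  shows "A x \<bullet> x \<le> Max (eigenvalues V A) * (x \<bullet> x)"
proof -
  obtain e where "eigenbasis V A e" using eigenbasis_exists[OF A] by blast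
  note e = eigenbasisD[OF this]
  have "eigenvalue_list V A ! i \<le> Max (eigenvalues V A)" if "i < dim V" for i
    using that nth_mem[of i "eigenvalue_list V A"]
    unfolding set_eigenvalue_list[OF A, symmetric] length_eigenvalue_list[OF A] by simp
  then show ?thesis
    unfolding e(5)[OF x] e(4)[OF x, symmetric] sum_distrib_left by (intro sum_mono mult_right_mono) auto
qed

lemma Max_eigenvalues_eigenvector:
  assumes A: "self_adjoint_on V A" and "V \<noteq> {0}"
  obtains v where "v \<in> V" "norm v = 1" "A v \<bullet> v = Max (eigenvalues V A)"
proof -
  obtain u \<mu> where u: "u \<in> V" "norm u = 1" "A u = \<mu> *\<^sub>R u"
    using self_adjoint_on_eigenvector_exists[OF assms] by metis
  moreover from u have "u \<noteq> 0" by auto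
  ultimately have "\<mu> \<in> eigenvalues V A" by (auto simp: eigenvalues_def)
  moreover have "finite (eigenvalues V A)"
    unfolding set_eigenvalue_list[OF A, symmetric] by simp
  ultimately have "Max (eigenvalues V A) \<in> eigenvalues V A" by (intro Max_in) auto
  then obtain w where w: "w \<in> V" "w \<noteq> 0" "A w = Max (eigenvalues V A) *\<^sub>R w"
    by (auto simp: eigenvalues_def)
  show thesis
  proof (rule that)
    show "(1 / norm w) *\<^sub>R w \<in> V" using w self_adjoint_onD(1)[OF A] by (intro subspace_scale)
    show "norm ((1 / norm w) *\<^sub>R w) = 1" using w by simp
    show "A ((1 / norm w) *\<^sub>R w) \<bullet> ((1 / norm w) *\<^sub>R w) = Max (eigenvalues V A)"
      using w self_adjoint_onD(4)[OF A]
      by (simp add: field_simps power2_norm_eq_inner[symmetric] power2_eq_square)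
  qed
qed


section \<open>Sums of the smallest eigenvalues\<close>

text \<open>Bathtub principle: subtract a threshold t separating the first k entries from the rest.
  Weight 1 on the nonpositive differences and 0 on the others is cheapest, and the subtraction
  removes r t from both sides.\<close>

lemma sorted_frac_sum_le_weighted:
  fixes xs :: "real list" and r :: real
  assumes "sorted xs" "0 \<le> r" "r \<le> length xs"
    and w: "\<And>i. i < length xs \<Longrightarrow> 0 \<le> w i \<and> w i \<le> 1" "(\<Sum>i<length xs. w i) = r"
  shows "(\<Sum>i<nat \<lfloor>r\<rfloor>. xs ! i) + (r - of_int \<lfloor>r\<rfloor>) * xs ! nat \<lfloor>r\<rfloor> \<le> (\<Sum>i<length xs. w i * xs ! i)"
proof -
  define k where "k = nat \<lfloor>r\<rfloor>"
  define t where "t = xs ! (if k < length xs then k else length xs - 1)"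
  have kr: "real k = of_int \<lfloor>r\<rfloor>" using assms(2) by (simp add: k_def)
  have "real k \<le> r" unfolding kr by simp
  then have kd: "k \<le> length xs" using assms(3) by linarith
  have low: "xs ! i \<le> t" if "i < k" for i
    using that kd assms(1) unfolding t_def by (auto intro!: sorted_nth_mono)
  have high: "t \<le> xs ! i" if "k \<le> i" "i < length xs" for i
    using that assms(1) unfolding t_def by (auto intro!: sorted_nth_mono)
  have frac: "(r - of_int \<lfloor>r\<rfloor>) * xs ! k = (r - k) * t"
  proof (cases "k < length xs")
    case True
    then show ?thesis by (simp add: t_def kr)
  next
    case False
    then have "r = k" using kd assms(3) \<open>real k \<le> r\<close> by linarith
    then show ?thesis by (simp add: kr[symmetric])
  qed
  have "(\<Sum>i<k. xs ! i) + (r - k) * t = (\<Sum>i<k. xs ! i - t) + r * t"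
    by (simp add: sum_subtractf algebra_simps)
  also have "(\<Sum>i<k. xs ! i - t) = (\<Sum>i<length xs. if i < k then xs ! i - t else 0)"
    using kd by (intro sum.mono_neutral_cong_left) auto
  also have "\<dots> \<le> (\<Sum>i<length xs. w i * (xs ! i - t))"
  proof (rule sum_mono)
    fix i assume i: "i \<in> {..<length xs}"
    show "(if i < k then xs ! i - t else 0) \<le> w i * (xs ! i - t)"
    proof (cases "i < k")
      case True
      have "(1 - w i) * (xs ! i - t) \<le> 0"
        using low[OF True] w(1)[of i] i by (intro mult_nonneg_nonpos) auto
      then show ?thesis using True by (simp add: algebra_simps)
    next
      case False
      then show ?thesis using high[of i] w(1)[of i] i by simp
    qed
  qed
  also have "\<dots> + r * t = (\<Sum>i<length xs. w i * xs ! i)"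
    unfolding w(2)[symmetric] by (simp add: algebra_simps sum_subtractf sum_distrib_left)
  finally show ?thesis using frac by (simp add: k_def)
qed

text \<open>The witness is the greedy choice: 1 on the first k entries, the fractional part of r on
  the next, 0 beyond. Hence the lower bound over weights is attained.\<close>

lemma frac_sum_eq_weighted:
  fixes xs :: "real list" and r :: real
  assumes "0 \<le> r" "r \<le> length xs"
  shows "\<exists>w. (\<forall>i. 0 \<le> w i \<and> w i \<le> (1::real)) \<and> (\<Sum>i<length xs. w i) = r \<and>
    (\<Sum>i<nat \<lfloor>r\<rfloor>. xs ! i) + (r - of_int \<lfloor>r\<rfloor>) * xs ! nat \<lfloor>r\<rfloor> = (\<Sum>i<length xs. w i * xs ! i)"
proof -
  define k where "k = nat \<lfloor>r\<rfloor>"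
  have kr: "real k = of_int \<lfloor>r\<rfloor>" using assms(1) by (simp add: k_def)
  have kle: "real k \<le> r" unfolding kr by simp
  then have kd: "k \<le> length xs" using assms(2) by linarith
  define w where "w i = (if i < k then 1 else if i = k then r - k else 0)" for i
  \<comment> \<open>For f = 1 this is the total weight, for f = \<open>(!) xs\<close> the eigenvalue
    sum.\<close>
  have gen: "(\<Sum>i<length xs. w i * f i) = (\<Sum>i<k. f i) + (r - k) * f k" for f :: "nat \<Rightarrow> real"
  proof -
    have "(\<Sum>i<length xs. w i * f i)
        = (\<Sum>i<length xs. (if i < k then f i else 0) + (if i = k then (r - k) * f k else 0))"
      by (intro sum.cong) (auto simp: w_def)
    also have "\<dots> = (\<Sum>i<k. f i) + (if k < length xs then (r - k) * f k else 0)"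
    proof -
      have "(\<Sum>i<length xs. if i < k then f i else 0) = (\<Sum>i<k. f i)"
        using kd by (intro sum.mono_neutral_cong_right) auto
      then show ?thesis by (simp add: sum.distrib)
    qed
    also have "(if k < length xs then (r - k) * f k else 0) = (r - k) * f k"
      using kd kle assms(2) by (cases "k = length xs") auto
    finally show ?thesis .
  qed
  show ?thesis
  proof (intro exI[of _ w] conjI)
    have "r < real k + 1" using assms(1) by (simp add: kr)
    then show "\<forall>i. 0 \<le> w i \<and> w i \<le> 1" using kle by (auto simp: w_def)
    show "(\<Sum>i<length xs. w i) = r" using gen[of "\<lambda>_. 1"] by simp
    show "(\<Sum>i<nat \<lfloor>r\<rfloor>. xs ! i) + (r - of_int \<lfloor>r\<rfloor>) * xs ! nat \<lfloor>r\<rfloor> = (\<Sum>i<length xs. w i * xs ! i)"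
      using gen[of "(!) xs"] by (simp add: k_def[symmetric] kr)
  qed
qed

text \<open>Scaling the optimal weights for s by r/s \<le> 1 gives admissible weights of total
  r.\<close>

lemma eig_sum_average_mono:
  fixes r s :: real
  assumes A: "self_adjoint_on V A" and rs: "0 < r" "r \<le> s" "s \<le> dim V"
  shows "eig_sum V r A / r \<le> eig_sum V s A / s"
proof -
  define xs where "xs = eigenvalue_list V A"
  have xs: "length xs = dim V" "sorted xs"
    unfolding xs_def by (rule length_eigenvalue_list[OF A], rule sorted_eigenvalue_list[OF A])
  have "0 \<le> s" "s \<le> length xs" using rs xs(1) by auto
  from frac_sum_eq_weighted[OF this]
  obtain w where w: "\<forall>i. 0 \<le> w i \<and> w i \<le> (1::real)" "(\<Sum>i<length xs. w i) = s"
    "eig_sum V s A = (\<Sum>i<length xs. w i * xs ! i)"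
    unfolding eig_sum_def Let_def xs_def[symmetric] by blast
  have "eig_sum V r A \<le> (\<Sum>i<length xs. (r / s * w i) * xs ! i)"
    unfolding eig_sum_def Let_def xs_def[symmetric]
  proof (rule sorted_frac_sum_le_weighted)
    fix i
    from w(1) show "0 \<le> r / s * w i \<and> r / s * w i \<le> 1"
      using rs mult_le_one[of "r / s" "w i"] by auto
  next
    show "(\<Sum>i<length xs. r / s * w i) = r"
      using w(2) rs unfolding sum_distrib_left[symmetric] by simp
  qed (use rs xs in auto)
  also have "\<dots> = r / s * eig_sum V s A"
    by (simp add: w(3) sum_distrib_left mult_ac)
  finally show ?thesis using rs by (simp add: field_simps)
qed

lemma eig_sum_dim:
  "eig_sum V (dim V) A = (\<Sum>i<dim V. eigenvalue_list V A ! i)"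
  by (simp add: eig_sum_def)


section \<open>Traces of curvature operators\<close>

lemma subspace_wedge2: "subspace (wedge2 :: (real^'n^'n) set)"
proof -
  have "transpose (x + y) = transpose x + transpose y" "transpose (c *\<^sub>R x) = c *\<^sub>R transpose x"
    "transpose 0 = (0 :: real^'n^'n)" for x y :: "real^'n^'n" and c
    by (simp_all add: transpose_def vec_eq_iff)
  then show ?thesis by (simp add: subspace_def wedge2_def)
qed

lemma self_adjoint_on_wedge2:
  assumes "R \<in> Sym2b"
  shows "self_adjoint_on wedge2 R"
proof -
  have "R v \<bullet> w = v \<bullet> R w" if "v \<in> wedge2" "w \<in> wedge2" for v w
  proof -
    have "wedge_inner (R v) w = wedge_inner v (R w)" using assms that unfolding Sym2b_def by blast
    then show ?thesis by (simp add: wedge_inner_def)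
  qed
  moreover have "linear_operator_on wedge2 R" using assms unfolding Sym2b_def by blast
  ultimately show ?thesis using subspace_wedge2 unfolding self_adjoint_on_def by blast
qed

text \<open>The two terms of \<open>wedge x y\<close> contribute equally because \<open>b\<close> is
  skew; hence the factor 2.\<close>

lemma inner_wedge_eq_matrix:
  fixes b :: "real^'n^'n"
  assumes "b \<in> wedge2"
  shows "wedge x y \<bullet> b = 2 * (x \<bullet> (b *v y))"
proof -
  have skew: "b $ j $ i = - (b $ i $ j)" for i j
  proof -
    have "transpose b $ i $ j = - (b $ i $ j)" using assms by (simp add: wedge2_def)
    then show ?thesis by (simp add: transpose_def)
  qed
  have "wedge x y \<bullet> b = (\<Sum>i\<in>UNIV. \<Sum>j\<in>UNIV. x $ i * y $ j * b $ i $ j)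
      - (\<Sum>i\<in>UNIV. \<Sum>j\<in>UNIV. y $ i * x $ j * b $ i $ j)"
    by (simp add: inner_vec_def wedge_def algebra_simps sum_subtractf)
  also have "(\<Sum>i\<in>UNIV. \<Sum>j\<in>UNIV. y $ i * x $ j * b $ i $ j)
      = (\<Sum>j\<in>UNIV. \<Sum>i\<in>UNIV. y $ i * x $ j * b $ i $ j)"
    by (rule sum.swap)
  also have "\<dots> = - (\<Sum>i\<in>UNIV. \<Sum>j\<in>UNIV. x $ i * y $ j * b $ i $ j)"
    unfolding sum_negf[symmetric] by (intro sum.cong refl) (subst skew, simp)
  finally show ?thesis
    by (simp add: inner_vec_def matrix_vector_mult_def sum_distrib_left mult_ac)
qed

section \<open>The Ricci operator and the scalar curvature as traces\<close>

lemma linear_wedge_right: "linear (wedge (x :: real^'n))"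
  by (rule linearI) (auto simp: wedge_def vec_eq_iff algebra_simps)

lemma Ric_inner:
  fixes R :: "real^'n^'n \<Rightarrow> real^'n^'n"
  shows "Ric R x \<bullet> y = (\<Sum>i\<in>UNIV. wedge_inner (R (wedge (axis i 1) x)) (wedge (axis i 1) y))"
proof -
  have "wedge (axis i 1) (\<Sum>k\<in>UNIV. y $ k *\<^sub>R axis k 1)
      = (\<Sum>k\<in>UNIV. y $ k *\<^sub>R wedge (axis i 1) (axis k 1))" for i :: 'n
    by (simp only: linear_sum[OF linear_wedge_right] linear_scale[OF linear_wedge_right])
  then have "wedge (axis i 1) y = (\<Sum>k\<in>UNIV. y $ k *\<^sub>R wedge (axis i 1) (axis k 1))" for i :: 'n
    using basis_expansion[of y] by (simp only: scalar_mult_eq_scaleR)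
  then have "(\<Sum>i\<in>UNIV. wedge_inner (R (wedge (axis i 1) x)) (wedge (axis i 1) y))
     = (\<Sum>i\<in>UNIV. \<Sum>k\<in>UNIV. y $ k * wedge_inner (R (wedge (axis i 1) x)) (wedge (axis i 1) (axis k 1)))"
    by (simp add: wedge_inner_def inner_sum_right sum_divide_distrib)
  also have "\<dots> = Ric R x \<bullet> y"
    by (subst sum.swap) (simp add: Ric_def inner_vec_def sum_distrib_left mult_ac)
  finally show ?thesis by simp
qed

lemma self_adjoint_on_Ric:
  assumes R: "self_adjoint_on wedge2 R"
  shows "self_adjoint_on UNIV (Ric R)"
proof -
  note RD = self_adjoint_onD[OF R]
  have "Ric R (x + y) = Ric R x + Ric R y" for x y
    by (simp add: Ric_def vec_eq_iff linear_add[OF linear_wedge_right] RD(3)[OF wedge_in_wedge2 wedge_in_wedge2]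
      wedge_inner_def inner_add_left add_divide_distrib sum.distrib)
  moreover have "Ric R (c *\<^sub>R x) = c *\<^sub>R Ric R x" for c x
    by (simp add: Ric_def vec_eq_iff linear_scale[OF linear_wedge_right] RD(4)[OF wedge_in_wedge2]
      wedge_inner_def sum_distrib_left)
  moreover have "Ric R x \<bullet> y = x \<bullet> Ric R y" for x y
  proof -
    have "R (wedge a x) \<bullet> wedge a y = R (wedge a y) \<bullet> wedge a x" for a
      using RD(5)[OF wedge_in_wedge2 wedge_in_wedge2] by (metis inner_commute)
    then have "Ric R x \<bullet> y = Ric R y \<bullet> x" by (simp add: Ric_inner wedge_inner_def)
    then show ?thesis by (metis inner_commute)
  qed
  ultimately show ?thesis
    by (simp add: self_adjoint_on_def linear_operator_on_def)
qed

lemma Ric_uminus: "Ric (\<lambda>\<omega>. - R \<omega>) x = - Ric R x"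
  by (simp add: Ric_def vec_eq_iff wedge_inner_def sum_negf)

lemma scal_eq_Ric: "scal R = (\<Sum>k\<in>UNIV. Ric R (axis k 1) \<bullet> axis k 1)"
  by (simp add: scal_eq_sum Ric_inner)

lemma scal_uminus: "scal (\<lambda>\<omega>. - R \<omega>) = - scal R"
  by (simp add: scal_eq_Ric Ric_uminus sum_negf)

text \<open>Each \<open>\<omega> \<in> \<Lambda>\<^sup>2\<close> satisfies \<open>\<Sum>\<^sub>i\<^sub>k (\<omega> \<bullet> (e\<^sub>i \<and> e\<^sub>k))\<^sup>2 = 4 |\<omega>|\<^sup>2\<close>, so the sum defining \<open>scal\<close> is
  twice the trace in any orthonormal basis.\<close>

lemma scal_eq_sum_eigenvalues:
  fixes R :: "real^'n^'n \<Rightarrow> real^'n^'n"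
  assumes R: "self_adjoint_on wedge2 R"
  shows "scal R = 2 * (\<Sum>i<dim (wedge2 :: (real^'n^'n) set). eigenvalue_list wedge2 R ! i)"
proof -
  let ?d = "dim (wedge2 :: (real^'n^'n) set)"
  define \<nu> where "\<nu> i = eigenvalue_list wedge2 R ! i" for i
  obtain e where "eigenbasis wedge2 R e" using eigenbasis_exists[OF R] by blast
  note e = eigenbasisD[OF this]
  have co: "(wedge (axis j 1) (axis k 1) \<bullet> e i)\<^sup>2 = 4 * (e i $ j $ k)\<^sup>2" if "i < ?d" for i j k
    using inner_wedge_eq_matrix[OF e(1)[OF that], of "axis j 1" "axis k 1"]
    by (simp add: inner_axis' matrix_vector_mult_basis column_def power_mult_distrib)
  have nrm: "(\<Sum>k\<in>UNIV. \<Sum>j\<in>UNIV. (e i $ j $ k)\<^sup>2) = 1" if "i < ?d" for i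
  proof -
    have "(\<Sum>j\<in>UNIV. \<Sum>k\<in>UNIV. (e i $ j $ k)\<^sup>2) = e i \<bullet> e i"
      by (simp add: inner_vec_def power2_eq_square)
    then show ?thesis using e(2)[OF that] by (subst sum.swap) (simp add: norm_eq_1)
  qed
  have "scal R = (\<Sum>k\<in>UNIV. \<Sum>j\<in>UNIV. \<Sum>i<?d. 2 * \<nu> i * (e i $ j $ k)\<^sup>2)"
    by (simp add: scal_eq_sum wedge_inner_def e(5)[OF wedge_in_wedge2] \<nu>_def co sum_divide_distrib mult_ac)
  also have "\<dots> = (\<Sum>k\<in>UNIV. \<Sum>i<?d. \<Sum>j\<in>UNIV. 2 * \<nu> i * (e i $ j $ k)\<^sup>2)"
    by (intro sum.cong refl sum.swap)
  also have "\<dots> = (\<Sum>i<?d. \<Sum>k\<in>UNIV. \<Sum>j\<in>UNIV. 2 * \<nu> i * (e i $ j $ k)\<^sup>2)"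
    by (rule sum.swap)
  also have "\<dots> = (\<Sum>i<?d. 2 * \<nu> i)"
    by (simp add: sum_distrib_left[symmetric] nrm)
  finally show ?thesis by (simp add: \<nu>_def sum_distrib_left)
qed

text \<open>The trace formula for the identity, whose eigenvalues are all 1: \<open>scal\<close> is
  then twice the dimension.\<close>

lemma dim_wedge2: "2 * real (dim (wedge2 :: (real^'n^'n) set)) = real CARD('n) * (real CARD('n) - 1)"
proof -
  let ?d = "dim (wedge2 :: (real^'n^'n) set)"
  have I: "self_adjoint_on (wedge2 :: (real^'n^'n) set) (\<lambda>\<omega>. \<omega>)"
    by (simp add: self_adjoint_on_def linear_operator_on_def subspace_wedge2)
  obtain e where "eigenbasis wedge2 (\<lambda>\<omega>::real^'n^'n. \<omega>) e" using eigenbasis_exists[OF I] by blast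
  note e = eigenbasisD[OF this]
  have "eigenvalue_list wedge2 (\<lambda>\<omega>::real^'n^'n. \<omega>) ! i = 1" if "i < ?d" for i
    using e(2,3)[OF that] by (metis norm_zero scaleR_one scaleR_right_imp_eq zero_neq_one)
  then show ?thesis
    using scal_eq_sum_eigenvalues[OF I] by (simp add: scal_id)
qed

text \<open>In an eigenbasis \<open>(\<omega>\<^sub>i)\<close>, \<open>\<langle>Ric x, x\<rangle>\<close> is the sum of the \<open>\<nu>\<^sub>i\<close> with weights \<open>w\<^sub>i = 2 |\<omega>\<^sub>i x|\<^sup>2\<close>;
  Cauchy-Schwarz for \<open>\<omega>\<^sub>i\<close> and \<open>\<omega>\<^sub>i x \<and> x\<close> gives \<open>w\<^sub>i \<le> 1\<close>.\<close>

lemma eig_sum_le_Ric: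
  fixes R :: "real^'n^'n \<Rightarrow> real^'n^'n"
  assumes R: "self_adjoint_on wedge2 R" and x: "norm x = 1" and n: "CARD('n) \<ge> 2"
  shows "eig_sum wedge2 (real CARD('n) - 1) R \<le> Ric R x \<bullet> x"
proof -
  let ?d = "dim (wedge2 :: (real^'n^'n) set)"
  define \<nu> where "\<nu> = eigenvalue_list wedge2 R"
  have \<nu>: "length \<nu> = ?d" "sorted \<nu>"
    unfolding \<nu>_def by (rule length_eigenvalue_list[OF R], rule sorted_eigenvalue_list[OF R])
  obtain e where "eigenbasis wedge2 R e" using eigenbasis_exists[OF R] by blast
  note e = eigenbasisD[OF this, folded \<nu>_def]
  have xx: "x \<bullet> x = 1" using x by (simp add: norm_eq_1)
  define w where "w i = (\<Sum>j\<in>UNIV. (wedge (axis j 1) x \<bullet> e i)\<^sup>2) / 2" for i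
  have w: "w i = 2 * ((e i *v x) \<bullet> (e i *v x))" if "i < ?d" for i
    by (simp add: w_def inner_wedge_eq_matrix[OF e(1)[OF that]] inner_axis' power_mult_distrib
        sum_distrib_left[symmetric]) (simp add: inner_vec_def power2_eq_square)
  have w1: "w i \<le> 1" if i: "i < ?d" for i
  proof -
    define y where "y = e i *v x"
    have "wedge x x \<bullet> e i = 0" by (simp add: wedge_def inner_vec_def)
    then have xy: "x \<bullet> y = 0"
      using inner_wedge_eq_matrix[OF e(1)[OF i], of x x] by (simp add: y_def)
    have "wedge y x \<bullet> e i = 2 * (y \<bullet> y)"
      using inner_wedge_eq_matrix[OF e(1)[OF i], of y x] by (simp add: y_def)
    moreover have "wedge y x \<bullet> wedge y x = 2 * (y \<bullet> y)"
      using wedge_inner_wedge[of y x y x] xx xy by (simp add: wedge_inner_def inner_commute)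
    moreover have "(wedge y x \<bullet> e i)\<^sup>2 \<le> (wedge y x \<bullet> wedge y x) * (e i \<bullet> e i)"
      by (rule Cauchy_Schwarz_ineq)
    moreover have "e i \<bullet> e i = 1" using e(2)[OF i] by (simp add: norm_eq_1)
    \<comment> \<open>Cauchy-Schwarz says that a = 2 |y|^2 satisfies a^2 \<le> a; hence a \<le>
      1.\<close>
    ultimately have "(2 * (y \<bullet> y)) * (2 * (y \<bullet> y)) \<le> 1 * (2 * (y \<bullet> y))"
      by (simp add: power2_eq_square)
    then have "2 * (y \<bullet> y) \<le> 1"
      by (metis inner_ge_zero mult_le_cancel_right not_le mult_nonneg_nonneg zero_le_numeral
          order_le_less zero_le_one)
    then show ?thesis by (simp add: w[OF i] y_def)
  qed
  \<comment> \<open>By Parseval, the total weight is the Ricci curvature of the identity operator at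
    x.\<close>
  have "(\<Sum>i<?d. w i) = (\<Sum>j\<in>UNIV. \<Sum>i<?d. (wedge (axis j 1) x \<bullet> e i)\<^sup>2) / 2"
    unfolding w_def sum_divide_distrib[symmetric] by (subst sum.swap) simp
  also have "\<dots> = Ric (\<lambda>\<omega>. \<omega>) x \<bullet> x"
    by (simp add: e(4)[OF wedge_in_wedge2] Ric_inner wedge_inner_def sum_divide_distrib)
  also have "\<dots> = real CARD('n) - 1" by (simp add: Ric_id xx)
  finally have sw: "(\<Sum>i<?d. w i) = real CARD('n) - 1" .
  have "Ric R x \<bullet> x = (\<Sum>j\<in>UNIV. \<Sum>i<?d. \<nu> ! i * (wedge (axis j 1) x \<bullet> e i)\<^sup>2) / 2"
    by (simp add: Ric_inner wedge_inner_def e(5)[OF wedge_in_wedge2] sum_divide_distrib)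
  also have "\<dots> = (\<Sum>i<?d. w i * \<nu> ! i)"
    unfolding w_def
    by (subst sum.swap) (simp add: sum_distrib_left sum_distrib_right sum_divide_distrib mult_ac)
  finally have Ric: "Ric R x \<bullet> x = (\<Sum>i<?d. w i * \<nu> ! i)" .
  \<comment> \<open>Ensures that the index n - 1 does not exceed the dimension n(n - 1)/2.\<close>
  have "2 * (real CARD('n) - 1) \<le> real CARD('n) * (real CARD('n) - 1)"
    using n by (intro mult_right_mono) auto
  then have "real CARD('n) - 1 \<le> ?d" unfolding dim_wedge2[where 'n = 'n, symmetric] by simp
  then show ?thesis
    unfolding eig_sum_def Let_def \<nu>_def[symmetric] Ric \<nu>(1)[symmetric]
    using n w1 \<nu> sw by (intro sorted_frac_sum_le_weighted) (auto simp: w_def intro!: sum_nonneg)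
qed


section \<open>Comparison of the curvature quantities\<close>

text \<open>The numerator of \<open>r_par n p\<close> is n(n - 1) + 8p(n + p - 1), and its
  denominator is 8 times the coefficient on the left.\<close>

lemma r_par_coeff:
  assumes "p \<ge> 1"
  shows "(real n / 8 + (real p)\<^sup>2 + real p) * r_par n p
    = real n * (real n - 1) / 8 + real p * (real n + real p - 1)"
proof -
  have "real n + 8 * real p * (real p + 1) > 0" using assms by (intro add_nonneg_pos) auto
  then show ?thesis by (simp add: r_par_def field_simps) (simp add: power2_eq_square algebra_simps)
qed

text \<open>Isolates the dependence on p in one fraction, from which both the bounds and the
  monotonicity are read off.\<close>

lemma r_par_eq:
  assumes "p \<ge> 1"
  shows "r_par n p = 1 + (real n - 2) * ((real n + 8 * real p) / (real n + 8 * real p * (real p + 1)))"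
proof -
  have "real n + 8 * real p * (real p + 1) > 0" using assms by (intro add_nonneg_pos) auto
  then show ?thesis by (simp add: r_par_def field_simps) (simp add: power2_eq_square algebra_simps)
qed

lemma r_par_antimono:
  assumes "1 \<le> q" "q \<le> p" "2 \<le> n"
  shows "r_par n p \<le> r_par n q"
proof -
  have "(real n + 8 * real p) / (real n + 8 * real p * (real p + 1))
      \<le> (real n + 8 * real q) / (real n + 8 * real q * (real q + 1))"
  proof -
    have pos: "real n + 8 * real p * (real p + 1) > 0" "real n + 8 * real q * (real q + 1) > 0"
      using assms by (auto intro!: add_nonneg_pos)
    have "(real n + 8 * real q) * (real n + 8 * real p * (real p + 1))
        - (real n + 8 * real p) * (real n + 8 * real q * (real q + 1))
        = 8 * (real p - real q) * (real n * (real p + real q) + 8 * real p * real q)"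
      by (simp add: algebra_simps)
    moreover have "\<dots> \<ge> 0" using assms by simp
    ultimately show ?thesis using pos by (simp add: divide_simps)
  qed
  then show ?thesis
    using assms by (simp only: r_par_eq order_trans[OF assms(1,2)])
      (intro add_left_mono mult_left_mono, auto)
qed

lemma r_par_bounds:
  assumes "1 \<le> p" "3 \<le> n"
  shows "1 \<le> r_par n p" "r_par n p \<le> real n * (real n - 1) / 2"
proof -
  show "1 \<le> r_par n p" using assms by (simp add: r_par_eq)
  have "real n + 8 * real p * (real p + 1) > 0" using assms by (intro add_nonneg_pos) auto
  then have "(real n + 8 * real p) / (real n + 8 * real p * (real p + 1)) \<le> 1"
    by (simp add: algebra_simps)
  then have "(real n - 2) * ((real n + 8 * real p) / (real n + 8 * real p * (real p + 1))) \<le> (real n - 2) * 1"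
    using assms by (intro mult_left_mono) auto
  then have "r_par n p \<le> real n - 1" using assms by (simp add: r_par_eq)
  also have "\<dots> \<le> real n * (real n - 1) / 2"
    using assms mult_right_mono[of 2 "real n" "real n - 1"] by simp
  finally show "r_par n p \<le> real n * (real n - 1) / 2" .
qed

lemma r_par'_bounds:
  assumes "1 \<le> p" "3 \<le> n"
  shows "1 \<le> r_par' n p" "r_par' n p \<le> real n * (real n - 1) / 2"
proof -
  show "1 \<le> r_par' n p" using assms by (simp add: r_par'_def field_simps)
  \<comment> \<open>The product equals p(n - 1) - (n + p - 2).\<close>
  have "0 \<le> (real n - 2) * (real p - 1)" using assms by simp
  then have "r_par' n p \<le> real n - 1" using assms by (simp add: r_par'_def field_simps)
  also have "\<dots> \<le> real n * (real n - 1) / 2"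
    using assms mult_right_mono[of 2 "real n" "real n - 1"] by simp
  finally show "r_par' n p \<le> real n * (real n - 1) / 2" .
qed

lemma r_par'_antimono:
  assumes "1 \<le> q" "q \<le> p" "2 \<le> n"
  shows "r_par' n p \<le> r_par' n q"
proof -
  have "r_par' n k = 1 + (real n - 2) / real k" if "k \<ge> 1" for k
    using that by (simp add: r_par'_def field_simps)
  then show ?thesis using assms by (simp add: divide_left_mono)
qed

theorem proposition4p9:
  fixes R :: "real^'n^'n \<Rightarrow> real^'n^'n" and p q :: nat
  assumes "CARD('n) \<ge> 3"
    and "1 \<le> q" and "q < p"
    and "R \<in> Sym2b"
    and "curv_C p R \<ge> 0"
  shows "scal R / 4 \<ge> curv_C q R \<and> curv_C q R \<ge> curv_C p R"
proof -
  define n where "n = CARD('n)"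
  have n3: "n \<ge> 3" using assms(1) by (simp add: n_def)
  have R: "self_adjoint_on wedge2 R" by (rule self_adjoint_on_wedge2[OF assms(4)])
  have R': "self_adjoint_on wedge2 (\<lambda>\<omega>. - R \<omega>)" by (rule self_adjoint_on_uminus[OF R])
  let ?W = "wedge2 :: (real^'n^'n) set"
  define K where "K = real n * (real n - 1) / 8"
  have Kpos: "K > 0" using n3 by (simp add: K_def)
  have d: "real (dim ?W) = 4 * K" using dim_wedge2[where 'n = 'n] by (simp add: K_def n_def)
  define m where "m = scal R / (8 * K)"
  have scal: "scal R = 8 * K * m" using Kpos by (simp add: m_def)
  define s where "s k = eig_sum wedge2 (r_par n k) R / r_par n k" for k
  define t where "t k = eig_sum wedge2 (r_par' n k) (\<lambda>\<omega>. - R \<omega>) / r_par' n k" for k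
  \<comment> \<open>At index \<open>4 * K\<close>, the dimension of \<open>wedge2\<close>, the
    average runs over the whole spectrum.\<close>
  have full: "eig_sum ?W (4 * K) R / (4 * K) = m"
    using eig_sum_dim[of ?W R] scal_eq_sum_eigenvalues[OF R] Kpos by (simp add: d m_def field_simps)
  have full': "eig_sum ?W (4 * K) (\<lambda>\<omega>. - R \<omega>) / (4 * K) = - m"
    using eig_sum_dim[of ?W "\<lambda>\<omega>. - R \<omega>"] scal_eq_sum_eigenvalues[OF R'] Kpos
    by (simp add: d m_def field_simps scal_uminus)
  have rb: "1 \<le> r_par n k" "r_par n k \<le> 4 * K" "1 \<le> r_par' n k" "r_par' n k \<le> 4 * K"
    if "k \<ge> 1" for k
    using r_par_bounds[of k n] r_par'_bounds[of k n] that n3 by (auto simp: K_def)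
  have s_le: "s k \<le> m" if "k \<ge> 1" for k
    using eig_sum_average_mono[OF R, of "r_par n k" "4 * K"] rb[OF that] full d by (simp add: s_def)
  have t_le: "t k \<le> - m" if "k \<ge> 1" for k
    using eig_sum_average_mono[OF R', of "r_par' n k" "4 * K"] rb[OF that] full' d by (simp add: t_def)
  have s_mono: "s p \<le> s q"
    using eig_sum_average_mono[OF R, of "r_par n p" "r_par n q"] rb[of q] rb[of p] d n3 assms(2,3)
      r_par_antimono[of q p n] by (simp add: s_def)
  have t_mono: "t p \<le> t q"
    using eig_sum_average_mono[OF R', of "r_par' n p" "r_par' n q"] rb[of q] rb[of p] d n3 assms(2,3)
      r_par'_antimono[of q p n] by (simp add: t_def)
  \<comment> \<open>\<open>E\<close> is what the coefficient of the first entry of the minimum has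
    beyond \<open>K\<close> once averages are used; \<open>D\<close> is the coefficient of
    \<open>t\<close>.\<close>
  define E where "E k = real k * (real n + real k - 1)" for k
  define D where "D k = real k * (real n + real k - 2)" for k
  have pos: "E k \<ge> 0" "D k \<ge> 0" "E k = D k + k" if "k \<ge> 1" for k
    using that n3 unfolding E_def D_def by (auto intro!: mult_nonneg_nonneg) (simp add: algebra_simps)
  have E_mono: "E q \<le> E p"
    unfolding E_def using assms(2,3) n3 by (intro mult_mono) auto
  have D_mono: "D q \<le> D p"
    unfolding D_def using assms(2,3) n3 by (intro mult_mono) auto
  have c1: "(real n / 8 + (real k)\<^sup>2 + real k) * eig_sum wedge2 (r_par n k) R = (K + E k) * s k"
    if "k \<ge> 1" for k
  proof -
    have "eig_sum wedge2 (r_par n k) R = r_par n k * s k" using rb(1)[OF that] by (simp add: s_def)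
    then show ?thesis using r_par_coeff[OF that, of n] by (simp add: K_def E_def flip: mult.assoc)
  qed
  have c2: "real n * (real n - 1) / (8 * r_par n k) * eig_sum wedge2 (r_par n k) R = K * s k" for k
    by (simp add: s_def K_def)
  have c3: "(real k)\<^sup>2 * eig_sum wedge2 (r_par' n k) (\<lambda>\<omega>. - R \<omega>) = D k * t k" if "k \<ge> 1" for k
  proof -
    have "(real k)\<^sup>2 * r_par' n k = D k" using that by (simp add: r_par'_def D_def power2_eq_square)
    moreover have "eig_sum wedge2 (r_par' n k) (\<lambda>\<omega>. - R \<omega>) = r_par' n k * t k"
      using rb(3)[OF that] by (simp add: t_def)
    ultimately show ?thesis by (metis mult.assoc)
  qed
  have C: "curv_C k R = min ((K + E k) * s k) (K * s k) + K * m + D k * t k" if "k \<ge> 2" for k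
    using that c1[of k] c2[of k] c3[of k] by (simp add: curv_C_def Let_def n_def[symmetric] scal)
  define \<mu> where "\<mu> = Max (eigenvalues UNIV (Ric R))"
  have C1: "curv_C 1 R = min ((K + E 1) * s 1) (K * m) + K * m - \<mu>"
    using c1[of 1] by (simp add: curv_C_def Let_def n_def[symmetric] scal \<mu>_def add.commute)
  have Ric: "self_adjoint_on UNIV (Ric R)" by (rule self_adjoint_on_Ric[OF R])
  \<comment> \<open>Since \<open>r_par' n 1\<close> is n - 1, the right side is minus an eigenvalue
    sum of -R; the trace bound for -R at a top eigenvector of \<open>Ric R\<close> applies.\<close>
  have \<mu>_le: "\<mu> \<le> - (D 1 * t 1)"
  proof -
    have "(UNIV :: (real^'n) set) \<noteq> {0}"
      by (metis UNIV_I axis_eq_0_iff singletonD zero_neq_one)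
    then obtain v where v: "norm v = 1" "Ric R v \<bullet> v = \<mu>"
      using Max_eigenvalues_eigenvector[OF Ric] unfolding \<mu>_def by metis
    have "eig_sum wedge2 (real CARD('n) - 1) (\<lambda>\<omega>. - R \<omega>) \<le> - \<mu>"
      using eig_sum_le_Ric[OF R' v(1)] n3 v(2) by (simp add: n_def Ric_uminus)
    then show ?thesis using c3[of 1] by (simp add: r_par'_def n_def)
  qed
  \<comment> \<open>\<open>scal R\<close> is the trace of \<open>Ric R\<close>, a sum of n diagonal
    values each at most \<mu>.\<close>
  have \<mu>_ge: "scal R \<le> n * \<mu>"
    using sum_mono[of UNIV "\<lambda>k. Ric R (axis k 1) \<bullet> axis k 1" "\<lambda>_. \<mu>"]
      self_adjoint_on_le_Max_eigenvalues[OF Ric, of "axis _ 1"]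
    by (simp add: scal_eq_Ric \<mu>_def n_def)
  have m0: "m \<ge> 0"
  proof (rule ccontr)
    assume "\<not> m \<ge> 0"
    then have "m < 0" by simp
    have "curv_C p R \<le> (K + E p) * s p + K * m + D p * t p"
      using C[of p] assms(2,3) by simp
    \<comment> \<open>Replacing the averages by their bounds m and -m cancels all of
      \<open>E p\<close> but p.\<close>
    also have "\<dots> \<le> (K + E p) * m + K * m + D p * (- m)"
      using s_le[of p] t_le[of p] pos[of p] Kpos assms(2,3)
      by (intro add_mono mult_left_mono order_refl) auto
    also have "\<dots> = (2 * K + p) * m"
      using pos(3)[of p] assms(2,3) by (simp add: algebra_simps)
    also have "\<dots> < 0" using \<open>m < 0\<close> Kpos by (intro mult_pos_neg) auto
    finally show False using assms(5) by simp
  qed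
  have tneg: "t k \<le> 0" if "k \<ge> 1" for k using t_le[OF that] m0 by simp
  have first: "min ((K + E p) * s p) (K * s p) \<le> min ((K + E q) * s q) (K * s q)"
  proof -
    \<comment> \<open>First \<open>E\<close> is lowered at fixed \<open>s p\<close>, then
      \<open>s\<close> is raised. For s p \<ge> 0 the minimum is K s p, free of \<open>E\<close>;
      for s p < 0 a smaller \<open>E\<close> raises the first entry, which is the minimum.\<close>
    have "min ((K + E p) * s p) (K * s p) \<le> min ((K + E q) * s p) (K * s p)"
    proof (cases "s p \<ge> 0")
      case True
      have "E q \<ge> 0" using pos assms by simp
      then have "K * s p \<le> (K + E q) * s p" using True by (intro mult_right_mono) auto
      then show ?thesis by simp
    next
      case False
      then have "(K + E p) * s p \<le> (K + E q) * s p"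
        using E_mono by (intro mult_right_mono_neg) auto
      then show ?thesis by (simp add: min.coboundedI1 min_le_iff_disj)
    qed
    also have "\<dots> \<le> min ((K + E q) * s q) (K * s q)"
      using s_mono pos(1)[of q] Kpos assms by (intro min.mono mult_left_mono) auto
    finally show ?thesis .
  qed
  have second: "D p * t p \<le> D q * t q"
  proof -
    \<comment> \<open>Lowering \<open>D\<close> needs t p \<le> 0; raising \<open>t\<close>
      afterwards needs D q \<ge> 0.\<close>
    have "D p * t p \<le> D q * t p"
      using D_mono tneg[of p] assms by (intro mult_right_mono_neg) auto
    also have "\<dots> \<le> D q * t q" using t_mono pos(2)[of q] assms by (intro mult_left_mono) auto
    finally show ?thesis .
  qed
  have Ks: "K * s q \<le> K * m" using s_le[of q] Kpos assms by simp
  have Cp: "curv_C p R = min ((K + E p) * s p) (K * s p) + K * m + D p * t p"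
    using C[of p] assms(2,3) by simp
  show ?thesis
  proof (cases "q = 1")
    case True
    \<comment> \<open>Against the general formula, C_1 has K m for K s_1 and -\<mu> for D_1 t_1,
      both at least as large, so the lower bound persists. The upper bound 2 K m needs \<mu> \<ge>
      0.\<close>
    have "0 \<le> 8 * K * m" using m0 Kpos by simp
    then have "0 \<le> n * \<mu>" using \<mu>_ge by (simp only: scal)
    then have "\<mu> \<ge> 0" using n3 by (simp add: zero_le_mult_iff)
    moreover have "min ((K + E p) * s p) (K * s p) \<le> min ((K + E q) * s q) (K * m)"
      using first Ks by (auto simp: min_le_iff_disj)
    moreover have "min ((K + E q) * s q) (K * m) \<le> K * m" by simp
    ultimately show ?thesis
      using True C1 Cp second \<mu>_le unfolding scal by auto
  next
    case False
    then have "q \<ge> 2" using assms by simp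
    \<comment> \<open>For the upper bound scal/4 = 2 K m, this term is dropped and the minimum is
      bounded by K m.\<close>
    moreover have "D q * t q \<le> 0" using pos(2)[of q] tneg[of q] assms by (simp add: mult_nonneg_nonpos)
    moreover have "min ((K + E q) * s q) (K * s q) \<le> K * m" using Ks by (rule min.coboundedI2)
    ultimately show ?thesis
      using C[of q] Cp first second unfolding scal by linarith
  qed
qed

end
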